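(* Let $A\in\mathbb{R}^{k\times n}$, $b\in\mathbb{R}^k$, and suppose $S:=\{x\in\mathbb{R}^n: b-Ax\ge0\}$ is compact. Let $a^i,c^i\in\mathbb{R}^n$, $g_i,h_i\in\mathbb{R}$ ($i=1,\ldots,m$) satisfy $(c^i)^Tx+h_i>0$ for all $x\in S$ and all $i=1,\ldots,m$. Let $w=(w_1,\ldots,w_n)>0$, $\|x\|:=\sum_{j=1}^nw_j|x_j|$, and $\delta>0$. For $x\in S$ and $i=1,\ldots,m$ define $$\tilde f_i(x):=\max_{y}\ \left\{\frac{(a^i)^Ty+g_i}{(c^i)^Ty+h_i}\ :\ \|y-x\|\le\delta,\ y\in S\right\},$$ which equals the optimal value of the linear optimization problem $$P_i(x):\qquad \begin{array}{llll}\max\limits_{\bar y_i,\theta_i,q_i} & (a^i)^T\bar y_i+g_i\theta_i & \\ \text{s.t.} & \bar y_i-\theta_ix\le q_i & (\pi_{i,1})\\ & -\bar y_i+\theta_ix\le q_i & (\pi_{i,2})\\ & w^Tq_i\le\theta_i\delta & (\gamma_i)\\ & (c^i)^T\bar y_i+h_i\theta_i=1 & (\tau_i)\\ & \theta_ib-A\bar y_i\ge0 & (\lambda_i)\\ & \theta_i\ge0 & (\kappa_i)\end{array}$$ where the dual variables are indicated in parentheses. Let $i\in\{1,\ldots,m\}$ be given. There is a set $B_i\subset S$ of measure zero which makes the following hold: suppose $x\in S\setminus B_i$, let $(\bar y_i^*,\theta_i^*,q_i^* )$ solve $P_i(x)$ and let $(\pi_{i,1}^*,\pi_{i,2}^*,\gamma_i^*,\tau_i^*,\lambda_i^*,\kappa_i^*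 )$ be optimal dual variables, and define $$p_i:=p_i(x):=\theta_i^*(\pi_{i,1}^*-\pi_{i,2}^* ).$$ Then $\nabla\tilde f_i(x)=p_i(x)$.
   Context: Vector inequalities are componentwise and measure zero refers to Lebesgue measure on $\mathbb{R}^n$. The variables of $P_i(x)$ are $\bar y_i\in\mathbb{R}^n$, $\theta_i\in\mathbb{R}$, $q_i\in\mathbb{R}^n$. The dual linear program of $P_i(x)$, with the convention that multipliers of inequality constraints are nonnegative, is: minimize $\tau_i$ subject to $\pi_{i,1}-\pi_{i,2}+\tau_ic^i+A^T\lambda_i=a^i$, $\ -x^T\pi_{i,1}+x^T\pi_{i,2}-\delta\gamma_i+h_i\tau_i-b^T\lambda_i-\kappa_i=g_i$, $\ -\pi_{i,1}-\pi_{i,2}+\gamma_iw=0$, $\ \pi_{i,1},\pi_{i,2}\in\mathbb{R}^n_+$, $\gamma_i\ge0$, $\lambda_i\in\mathbb{R}^k_+$, $\kappa_i\ge0$, $\tau_i$ free. *)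

theory Defs
  imports "HOL-Analysis.Analysis"
begin

definition poly_set :: "real^'n^'k \<Rightarrow> real^'k \<Rightarrow> (real^'n) set" where
  "poly_set A b = {x. 0 \<le> b - A *v x}"

definition wnorm :: "real^'n \<Rightarrow> real^'n \<Rightarrow> real" where
  "wnorm w x = (\<Sum>j\<in>UNIV. w $ j * \<bar>x $ j\<bar>)"

(* The maximum is used only near points of poly_set A b. There it is attained when this set is
   compact and the denominator is positive on it. *)
definition ftilde ::
  "real^'n^'k \<Rightarrow> real^'k \<Rightarrow> real^'n \<Rightarrow> real \<Rightarrow>
   real^'n \<Rightarrow> real \<Rightarrow> real^'n \<Rightarrow> real \<Rightarrow> real^'n \<Rightarrow> real" where
  "ftilde A b w \<delta> a g c h x =
     (GREATEST v. \<exists>y. wnorm w (y - x) \<le> \<delta> \<and> y \<in> poly_set A b \<and>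
        v = (a \<bullet> y + g) / (c \<bullet> y + h))"

(* The order on real^'n is componentwise. *)
definition primal_feasible ::
  "real^'n^'k \<Rightarrow> real^'k \<Rightarrow> real^'n \<Rightarrow> real \<Rightarrow> real^'n \<Rightarrow> real \<Rightarrow> real^'n \<Rightarrow>
   real^'n \<Rightarrow> real \<Rightarrow> real^'n \<Rightarrow> bool" where
  "primal_feasible A b w \<delta> c h x y \<theta> q \<longleftrightarrow>
     y - \<theta> *\<^sub>R x \<le> q \<and>
     - y + \<theta> *\<^sub>R x \<le> q \<and>
     w \<bullet> q \<le> \<theta> * \<delta> \<and>
     c \<bullet> y + h * \<theta> = 1 \<and>
     0 \<le> \<theta> *\<^sub>R b - A *v y \<and>
     0 \<le> \<theta>"

definition primal_optimal ::
  "real^'n^'k \<Rightarrow> real^'k \<Rightarrow> real^'n \<Rightarrow> real \<Rightarrow>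
   real^'n \<Rightarrow> real \<Rightarrow> real^'n \<Rightarrow> real \<Rightarrow> real^'n \<Rightarrow>
   real^'n \<Rightarrow> real \<Rightarrow> real^'n \<Rightarrow> bool" where
  "primal_optimal A b w \<delta> a g c h x y \<theta> q \<longleftrightarrow>
     primal_feasible A b w \<delta> c h x y \<theta> q \<and>
     (\<forall>y' \<theta>' q'. primal_feasible A b w \<delta> c h x y' \<theta>' q' \<longrightarrow>
        a \<bullet> y' + g * \<theta>' \<le> a \<bullet> y + g * \<theta>)"

definition dual_feasible ::
  "real^'n^'k \<Rightarrow> real^'k \<Rightarrow> real^'n \<Rightarrow> real \<Rightarrow>
   real^'n \<Rightarrow> real \<Rightarrow> real^'n \<Rightarrow> real \<Rightarrow> real^'n \<Rightarrow>
   real^'n \<Rightarrow> real^'n \<Rightarrow> real \<Rightarrow> real \<Rightarrow> real^'k \<Rightarrow> real \<Rightarrow> bool" where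
  "dual_feasible A b w \<delta> a g c h x \<pi>1 \<pi>2 \<gamma> \<tau> l \<kappa> \<longleftrightarrow>
     \<pi>1 - \<pi>2 + \<tau> *\<^sub>R c + transpose A *v l = a \<and>
     - (x \<bullet> \<pi>1) + x \<bullet> \<pi>2 - \<delta> * \<gamma> + h * \<tau> - b \<bullet> l - \<kappa> = g \<and>
     - \<pi>1 - \<pi>2 + \<gamma> *\<^sub>R w = 0 \<and>
     0 \<le> \<pi>1 \<and> 0 \<le> \<pi>2 \<and> 0 \<le> \<gamma> \<and> 0 \<le> l \<and> 0 \<le> \<kappa>"

definition dual_optimal ::
  "real^'n^'k \<Rightarrow> real^'k \<Rightarrow> real^'n \<Rightarrow> real \<Rightarrow>
   real^'n \<Rightarrow> real \<Rightarrow> real^'n \<Rightarrow> real \<Rightarrow> real^'n \<Rightarrow>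
   real^'n \<Rightarrow> real^'n \<Rightarrow> real \<Rightarrow> real \<Rightarrow> real^'k \<Rightarrow> real \<Rightarrow> bool" where
  "dual_optimal A b w \<delta> a g c h x \<pi>1 \<pi>2 \<gamma> \<tau> l \<kappa> \<longleftrightarrow>
     dual_feasible A b w \<delta> a g c h x \<pi>1 \<pi>2 \<gamma> \<tau> l \<kappa> \<and>
     (\<forall>\<pi>1' \<pi>2' \<gamma>' \<tau>' l' \<kappa>'.
        dual_feasible A b w \<delta> a g c h x \<pi>1' \<pi>2' \<gamma>' \<tau>' l' \<kappa>' \<longrightarrow> \<tau> \<le> \<tau>')"

end

theory Submission
  imports Defs
begin

text \<open>
For a centre \<open>x\<close>, write \<open>Q x\<close> for the set of competitors: the points of the polytope within weighted
\<open>l\<^sub>1\<close> distance \<open>\<delta>\<close> of \<open>x\<close>. The \<open>l\<^sub>1\<close> ball is cut out by one linear inequality per sign pattern, so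
\<open>Q x = {y. \<forall>k. G k \<bullet> y \<le> d k + e k \<bullet> x}\<close> is a polytope whose right-hand sides are affine in \<open>x\<close>. Let \<open>f\<close>
be the maximum of \<open>(a \<bullet> y + g) / (c \<bullet> y + h)\<close> over \<open>Q x\<close>. The optimal set is the intersection of \<open>Q x\<close>
with the hyperplane \<open>a \<bullet> y + g = f x * (c \<bullet> y + h)\<close>. It is compact and convex, and each of its extreme
points is determined by the constraints active there. Hence the extreme optima are values \<open>F x\<close> of
finitely many affine maps \<open>F\<close> that do not depend on \<open>x\<close> (\<open>finite_affine_family\<close>).

Dual multipliers with objective value \<open>f x\<close> and \<open>p = \<pi>1 - \<pi>2\<close> give the sensitivity inequality
\<open>a \<bullet> y + g - f x * (c \<bullet> y + h) \<le> p \<bullet> (x' - x)\<close> for all \<open>x'\<close> and all \<open>y \<in> Q x'\<close>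
(\<open>dual_feasible_imp_numerator_le\<close>). For almost every \<open>x\<close>, a constraint active at \<open>F x\<close> is active
along all of \<open>F\<close>, so \<open>F x' \<in> Q x'\<close> for \<open>x'\<close> near \<open>x\<close>. If \<open>F x\<close> is optimal, the sensitivity inequality
for \<open>y = F x'\<close> then compares two affine functions of \<open>x'\<close> that agree at \<open>x\<close>, so it is an
equality. Therefore, near \<open>x\<close>, every value of \<open>f\<close> has the form
\<open>f x + p \<bullet> (x' - x) / (c \<bullet> F x' + h)\<close> for some \<open>F\<close> optimal at \<open>x\<close>, and each of these functions has
gradient \<open>p / (c \<bullet> F x + h)\<close> at \<open>x\<close>.

It remains to see that the denominators agree. If two optimal \<open>F\<close>, \<open>F'\<close> have different
denominators and \<open>p \<noteq> 0\<close>, then \<open>x\<close> is a regular zero of the difference of the cross products of the two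
fractions, and regular zeros form a null set (\<open>negligible_regular_zero_set\<close>). So for almost every
\<open>x\<close>, unless \<open>p = 0\<close>, all extreme optima share one denominator, and by the Krein-Milman theorem so do
all optima \<open>z\<close>
(\<open>gradient_almost_everywhere\<close>). The homogenised variables satisfy \<open>z = y / \<theta>\<close> and \<open>c \<bullet> z + h = 1 / \<theta>\<close>,
so the gradient is \<open>\<theta> (\<pi>1 - \<pi>2)\<close>. Linear programming duality, which shows that an optimal
dual has objective value \<open>f x\<close>, comes from Farkas' lemma (\<open>affine_farkas\<close>).
\<close>

section \<open>Null sets, derivatives and Farkas' lemma\<close>
text \<open>
Close to a regular zero, the zero set is squeezed into a slab around the tangent hyperplane whose
thickness is small compared with the radius. So the zero set has density zero at each of its regular
points, and a set with density zero at all of its points is null.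
\<close>

lemma negligible_regular_zero_set:
  fixes H :: "'a::euclidean_space \<Rightarrow> real"
  shows "negligible {x. H x = 0 \<and> (\<exists>D. (H has_derivative D) (at x) \<and> D \<noteq> (\<lambda>_. 0))}"
  (is "negligible ?S")
  unfolding negligible_eq_zero_density
proof (intro ballI allI impI)
  fix x :: 'a and r e :: real
  assume xS: "x \<in> ?S" and r: "r > 0" and e: "e > 0"
  from xS obtain D where Hx: "H x = 0" and der: "(H has_derivative D) (at x)"
    and Dnz: "D \<noteq> (\<lambda>_. 0)" by auto
  have lin: "linear D" using der by (rule has_derivative_linear)
  define u where "u = adjoint D 1"
  have D: "D v = u \<bullet> v" for v
    using adjoint_works[OF lin, of v 1] by (simp add: u_def inner_commute)
  have u: "u \<noteq> 0" using Dnz D by auto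
  \<comment> \<open>Slabs of the unit ball shrink to its intersection with a hyperplane, hence to measure 0.\<close>
  define A where "A = (\<lambda>n::nat. ball 0 1 \<inter> {v. \<bar>u \<bullet> v\<bar> \<le> 1 / real (Suc n)})"
  have Ab: "A n \<in> sets borel" for n
    unfolding A_def by measurable
  have Am: "A n \<in> lmeasurable" for n
    using Ab[of n] unfolding A_def
    by (intro bounded_set_imp_lmeasurable) (auto intro: bounded_subset[OF bounded_ball])
  have "(\<lambda>n. measure lebesgue (A n)) \<longlonglongrightarrow> measure lebesgue (\<Inter>n. A n)"
  proof (rule Lim_measure_decseq)
    show "range A \<subseteq> sets lebesgue" using Am by (auto simp: fmeasurable_def)
    show "decseq A"
      unfolding A_def decseq_def by (force intro: order_trans simp: frac_le)
    show "emeasure lebesgue (A i) \<noteq> \<infinity>" for i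
      using Am[of i] by (auto simp: fmeasurable_def)
  qed
  moreover have "(\<Inter>n. A n) \<subseteq> {v. u \<bullet> v = 0}"
  proof
    fix v assume v: "v \<in> (\<Inter>n. A n)"
    have "u \<bullet> v = 0"
    proof (rule ccontr)
      assume "u \<bullet> v \<noteq> 0"
      then obtain n where "1 / real (Suc n) < \<bar>u \<bullet> v\<bar>"
        using nat_approx_posE[of "\<bar>u \<bullet> v\<bar>"] by auto
      moreover have "v \<in> A n" using v by blast
      ultimately show False by (simp add: A_def)
    qed
    then show "v \<in> {v. u \<bullet> v = 0}" by simp
  qed
  then have "negligible (\<Inter>n. A n)"
    using negligible_hyperplane[of u 0] u negligible_subset by blast
  then have "measure lebesgue (\<Inter>n. A n) = 0"
    by (simp add: negligible_imp_measure0)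
  ultimately have "(\<lambda>n. measure lebesgue (A n)) \<longlonglongrightarrow> 0" by simp
  moreover have "0 < e * measure lebesgue (ball (0::'a) 1)"
    using e content_ball_pos[of 1 "0::'a"] by simp
  ultimately have "\<forall>\<^sub>F n in sequentially. measure lebesgue (A n) < e * measure lebesgue (ball (0::'a) 1)"
    by (rule order_tendstoD)
  then obtain n where n: "measure lebesgue (A n) < e * measure lebesgue (ball (0::'a) 1)"
    by (auto simp: eventually_sequentially)
  obtain d where d: "d > 0"
    "\<And>y. norm (y - x) < d \<Longrightarrow> norm (H y - H x - D (y - x)) \<le> 1 / real (Suc n) * norm (y - x)"
    using der unfolding has_derivative_at_alt by (metis of_nat_0_less_iff zero_less_Suc zero_less_divide_1_iff)
  define s where "s = min d r"
  have s: "s > 0" "s \<le> d" "s \<le> r" using d r by (auto simp: s_def)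
  let ?U = "ball x s \<inter> {y. \<bar>u \<bullet> (y - x)\<bar> \<le> s / real (Suc n)}"
  \<comment> \<open>The slab in the small ball is a scaled copy of a slab in the unit ball, so the volume ratio is
     independent of the radius.\<close>
  have U: "?U = (\<lambda>v. s *\<^sub>R v + x) ` A n"
  proof (intro equalityI subsetI)
    fix y assume y: "y \<in> ?U"
    define v where "v = (y - x) /\<^sub>R s"
    have yv: "y = s *\<^sub>R v + x" using s by (simp add: v_def)
    have "s * norm v < s * 1" "s * \<bar>u \<bullet> v\<bar> \<le> s * (1 / real (Suc n))"
      using y s unfolding yv by (simp_all add: dist_norm abs_mult)
    then have "norm v < 1" "\<bar>u \<bullet> v\<bar> \<le> 1 / real (Suc n)"
      using s by (simp_all only: mult_less_cancel_left_pos mult_le_cancel_left_pos)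
    then have "v \<in> A n" by (simp add: A_def)
    then show "y \<in> (\<lambda>v. s *\<^sub>R v + x) ` A n" using yv by blast
  next
    fix y assume "y \<in> (\<lambda>v. s *\<^sub>R v + x) ` A n"
    then obtain v where yv: "y = s *\<^sub>R v + x" and "v \<in> A n" by blast
    then have "norm v < 1" "\<bar>u \<bullet> v\<bar> \<le> 1 / real (Suc n)" by (simp_all add: A_def)
    then have "s * norm v < s * 1" "s * \<bar>u \<bullet> v\<bar> \<le> s * (1 / real (Suc n))"
      using s by (simp_all only: mult_less_cancel_left_pos mult_le_cancel_left_pos)
    then show "y \<in> ?U" using s unfolding yv by (simp add: dist_norm abs_mult)
  qed
  show "\<exists>d>0. d \<le> r \<and> (\<exists>U. ?S \<inter> ball x d \<subseteq> U \<and> U \<in> lmeasurable \<and>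
          measure lebesgue U < e * measure lebesgue (ball x d))"
  proof (intro exI[of _ s] conjI exI[of _ ?U])
    show "s > 0" "s \<le> r" using s by auto
    show "?S \<inter> ball x s \<subseteq> ?U"
    proof
      fix y assume "y \<in> ?S \<inter> ball x s"
      then have Hy: "H y = 0" and y: "norm (y - x) < s"
        by (auto simp: dist_norm norm_minus_commute)
      have "\<bar>u \<bullet> (y - x)\<bar> \<le> 1 / real (Suc n) * norm (y - x)"
        using d(2)[of y] y s Hx Hy by (simp add: D)
      also have "\<dots> \<le> 1 / real (Suc n) * s"
        using y by (intro mult_left_mono) auto
      finally show "y \<in> ?U" using y by (simp add: dist_norm norm_minus_commute)
    qed
    show "?U \<in> lmeasurable"
    proof (rule bounded_set_imp_lmeasurable)
      show "bounded ?U" using bounded_ball by (rule bounded_subset) auto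
      have "?U \<in> sets borel" by measurable
      then show "?U \<in> sets lebesgue" by simp
    qed
    have "measure lebesgue ?U = s ^ DIM('a) * measure lebesgue (A n)"
      unfolding U using measure_lebesgue_affine[of s x "A n"] s by simp
    also have "\<dots> < s ^ DIM('a) * (e * measure lebesgue (ball (0::'a) 1))"
      using n s by simp
    also have "\<dots> = e * measure lebesgue (ball x s)"
      using content_ball_conv_unit_ball[of s x] s by (simp add: mult_ac)
    finally show "measure lebesgue ?U < e * measure lebesgue (ball x s)" .
  qed
qed

text \<open>
The selection may jump between members of \<open>W\<close> arbitrarily: near \<open>x\<close> a single error estimate serves all
of the finitely many members.
\<close>

lemma has_derivative_finite_selection:
  fixes f :: "'a::real_normed_vector \<Rightarrow> 'b::real_normed_vector"
  assumes "finite W"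
    and deriv: "\<And>\<phi>. \<phi> \<in> W \<Longrightarrow> (\<phi> has_derivative D) (at x) \<and> \<phi> x = f x"
    and sel: "\<forall>\<^sub>F y in nhds x. \<exists>\<phi>\<in>W. f y = \<phi> y"
  shows "(f has_derivative D) (at x)"
proof -
  have "W \<noteq> {}" using eventually_nhds_x_imp_x[OF sel] by auto
  then have bl: "bounded_linear D" using deriv has_derivative_bounded_linear by blast
  show ?thesis unfolding has_derivative_within_alt2
  proof (intro conjI allI impI bl)
    fix e :: real assume e: "e > 0"
    have "\<forall>\<^sub>F y in at x. \<forall>\<phi>\<in>W. norm (\<phi> y - \<phi> x - D (y - x)) \<le> e * norm (y - x)"
      using assms(1) deriv e unfolding has_derivative_within_alt2
      by (intro eventually_ball_finite) auto
    moreover have "\<forall>\<^sub>F y in at x. \<exists>\<phi>\<in>W. f y = \<phi> y"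
      using sel by (simp add: eventually_nhds_conv_at)
    ultimately show "\<forall>\<^sub>F y in at x. norm (f y - f x - D (y - x)) \<le> e * norm (y - x)"
      by eventually_elim (use deriv in metis)
  qed
qed

lemma eventually_inner_nonpos_imp_zero:
  fixes r x :: "'a::real_inner"
  assumes "\<forall>\<^sub>F y in nhds x. r \<bullet> (y - x) \<le> 0"
  shows "r = 0"
proof (rule ccontr)
  assume r: "r \<noteq> 0"
  have "((\<lambda>s. x + s *\<^sub>R r) \<longlongrightarrow> x + 0 *\<^sub>R r) (at_right (0::real))"
    by (intro tendsto_intros)
  then have "filterlim (\<lambda>s. x + s *\<^sub>R r) (nhds x) (at_right (0::real))" by simp
  from eventually_compose_filterlim[OF assms this] eventually_at_right_less[of 0]
  have "\<forall>\<^sub>F s in at_right (0::real). False"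
  proof eventually_elim
    case (elim s)
    then have "s * (r \<bullet> r) > 0" using r by simp
    moreover have "s * (r \<bullet> r) \<le> 0" using elim(1) by (simp only: add_diff_cancel_left' inner_scaleR_right)
    ultimately show False by linarith
  qed
  then show False by (simp add: trivial_limit_at_right_real)
qed

text \<open>
Homogenisation: the pair \<open>(u, \<beta>)\<close> is to be found in the cone generated by the constraint pairs
\<open>(G k, d k)\<close> and the slack direction \<open>(0, 1)\<close>. A finitely generated cone is closed, so otherwise a
hyperplane \<open>(-p, s)\<close> separates it off. If \<open>s > 0\<close> then \<open>p / s\<close> is a feasible point violating the
valid inequality; if \<open>s = 0\<close> then \<open>p\<close> is a recession direction along which \<open>u\<close> is unbounded, and this
is where a feasible point \<open>z\<close> is used.
\<close>

lemma affine_farkas: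
  fixes G :: "'i::finite \<Rightarrow> 'a::euclidean_space" and d :: "'i \<Rightarrow> real"
  assumes ne: "\<forall>k. G k \<bullet> z \<le> d k"
    and valid: "\<And>y. \<forall>k. G k \<bullet> y \<le> d k \<Longrightarrow> u \<bullet> y \<le> \<beta>"
  obtains \<mu> where "\<And>k. 0 \<le> \<mu> k" "u = (\<Sum>k\<in>UNIV. \<mu> k *\<^sub>R G k)" "(\<Sum>k\<in>UNIV. \<mu> k * d k) \<le> \<beta>"
proof -
  let ?gen = "insert (0, 1) (range (\<lambda>k. (G k, d k)))"
  let ?C = "{(v, t). \<exists>\<mu>. (\<forall>k. 0 \<le> \<mu> k) \<and> v = (\<Sum>k\<in>UNIV. \<mu> k *\<^sub>R G k) \<and> (\<Sum>k\<in>UNIV. \<mu> k * d k) \<le> t}"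
  have cone: "convex_cone ?C"
    unfolding convex_cone_iff
  proof (intro conjI ballI allI impI)
    show "0 \<in> ?C" by (auto simp: zero_prod_def intro!: exI[of _ "\<lambda>_. 0"])
  next
    fix p q assume "p \<in> ?C" "q \<in> ?C"
    then obtain \<mu> \<nu> where "\<forall>k. 0 \<le> \<mu> k" "fst p = (\<Sum>k\<in>UNIV. \<mu> k *\<^sub>R G k)"
      "(\<Sum>k\<in>UNIV. \<mu> k * d k) \<le> snd p" "\<forall>k. 0 \<le> \<nu> k" "fst q = (\<Sum>k\<in>UNIV. \<nu> k *\<^sub>R G k)"
      "(\<Sum>k\<in>UNIV. \<nu> k * d k) \<le> snd q" by (auto split: prod.splits)
    then show "p + q \<in> ?C"
      by (auto simp: case_prod_beta scaleR_add_left distrib_right sum.distrib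
          intro!: exI[of _ "\<lambda>k. \<mu> k + \<nu> k"])
  next
    fix p and t :: real assume "p \<in> ?C" and t: "0 \<le> t"
    then obtain \<mu> where "\<forall>k. 0 \<le> \<mu> k" "fst p = (\<Sum>k\<in>UNIV. \<mu> k *\<^sub>R G k)"
      "(\<Sum>k\<in>UNIV. \<mu> k * d k) \<le> snd p" by (auto split: prod.splits)
    with t show "t *\<^sub>R p \<in> ?C"
      by (auto simp: case_prod_beta scaleR_sum_right sum_distrib_left[symmetric] mult.assoc
          intro!: exI[of _ "\<lambda>k. t * \<mu> k"] mult_left_mono)
  qed
  have gen: "?gen \<subseteq> ?C"
  proof -
    have "(G j, d j) \<in> ?C" for j
      by (auto intro!: exI[of _ "\<lambda>k. if k = j then 1 else 0"] simp: if_distrib if_distribR cong: if_cong)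
    moreover have "(0, 1) \<in> ?C"
      by (auto intro!: exI[of _ "\<lambda>_. 0"])
    ultimately show ?thesis by auto
  qed
  have "(u, \<beta>) \<in> convex_cone hull ?gen"
  proof (rule ccontr)
    let ?K = "convex_cone hull ?gen"
    assume "(u, \<beta>) \<notin> ?K"
    moreover have "closed ?K" by (rule closed_convex_cone_hull) auto
    ultimately obtain n t where nt: "n \<bullet> (u, \<beta>) < t" "\<forall>x\<in>?K. n \<bullet> x > t"
      using separating_hyperplane_closed_point[OF convex_convex_cone_hull] by blast
    have K: "convex_cone ?K" by (rule convex_cone_convex_cone_hull)
    have t: "t < 0" using nt(2) convex_cone_contains_0[OF K] by force
    \<comment> \<open>A linear functional bounded below on a cone is nonnegative there: otherwise scaling the
       offending point reaches the bound \<open>t\<close> exactly.\<close>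
    have nn: "n \<bullet> q \<ge> 0" if q: "q \<in> ?K" for q
    proof (rule ccontr)
      assume "\<not> 0 \<le> n \<bullet> q"
      then have neg: "n \<bullet> q < 0" by simp
      then have "(t / (n \<bullet> q)) *\<^sub>R q \<in> ?K"
        using t q by (intro convex_cone_scaleR[OF K]) (auto simp: divide_nonpos_neg)
      with nt(2) neg show False by force
    qed
    obtain p s where n: "n = (- p, s)" by (metis minus_minus surj_pair)
    have s: "s \<ge> 0" using nn[OF hull_inc, of "(0,1)"] by (simp add: n)
    have Gk: "G k \<bullet> p \<le> s * d k" for k
      using nn[OF hull_inc, of "(G k, d k)"] by (simp add: n inner_commute)
    have obj: "u \<bullet> p > s * \<beta>" using nt(1) t by (simp add: n inner_commute mult.commute)
    show False
    proof (cases "s = 0")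
      case False
      with s have s: "s > 0" by simp
      have "u \<bullet> (p /\<^sub>R s) \<le> \<beta>"
        by (rule valid) (use Gk s in \<open>auto simp: field_simps\<close>)
      with obj s show False by (simp add: field_simps)
    next
      case True
      then have up: "u \<bullet> p > 0" using obj by simp
      \<comment> \<open>This step length lifts the objective from its value at \<open>z\<close> to above \<open>\<beta>\<close>.\<close>
      define r where "r = (\<bar>\<beta> - u \<bullet> z\<bar> + 1) / (u \<bullet> p)"
      have r: "r > 0" using up by (simp add: r_def add_nonneg_pos)
      have "u \<bullet> (z + r *\<^sub>R p) \<le> \<beta>"
      proof (rule valid, intro allI)
        fix k
        have "r * (G k \<bullet> p) \<le> 0" using Gk[of k] True r by (simp add: mult_nonneg_nonpos)
        then show "G k \<bullet> (z + r *\<^sub>R p) \<le> d k"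
          using ne[rule_format, of k] by (simp add: inner_add_right)
      qed
      then show False using up by (simp add: r_def inner_add_right)
    qed
  qed
  then have "(u, \<beta>) \<in> ?C"
    using hull_minimal[OF gen, of convex_cone] cone by blast
  then show thesis using that by auto
qed

section \<open>Fractional programs over a polytope with moving right-hand side\<close>
text \<open>
The system of the constraints in \<open>I\<close> may be overdetermined. A left inverse of the injective
coefficient map recovers the solution whenever one exists, without choosing a basis among the rows;
at parameters \<open>x\<close> where the system is inconsistent, \<open>L x + t\<close> need not satisfy it.
\<close>

lemma determined_solution_affine:
  fixes G :: "'i::finite \<Rightarrow> 'a::euclidean_space" and d :: "'i \<Rightarrow> real"
    and e :: "'i \<Rightarrow> 'b::real_inner"
  assumes ker: "\<And>v. \<forall>k\<in>I. G k \<bullet> v = 0 \<Longrightarrow> v = 0"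
  obtains L t where "linear L" "\<And>x y. \<forall>k\<in>I. G k \<bullet> y = d k + e k \<bullet> x \<Longrightarrow> y = L x + t"
proof -
  define T :: "'a \<Rightarrow> real^'i" where "T = (\<lambda>v. \<chi> k. if k \<in> I then G k \<bullet> v else 0)"
  define E :: "'b \<Rightarrow> real^'i" where "E = (\<lambda>x. \<chi> k. if k \<in> I then e k \<bullet> x else 0)"
  define \<tau> :: "real^'i" where "\<tau> = (\<chi> k. if k \<in> I then d k else 0)"
  have T: "linear T"
    by (rule linearI) (auto simp: T_def vec_eq_iff inner_add_right)
  have E: "linear E"
    by (rule linearI) (auto simp: E_def vec_eq_iff inner_add_right)
  have "inj T"
    unfolding linear_injective_0[OF T] using ker by (auto simp: T_def vec_eq_iff split: if_splits)
  then obtain R where R: "linear R" "R \<circ> T = id"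
    using linear_injective_left_inverse[OF T] by blast
  show thesis
  proof (rule that)
    show "linear (R \<circ> E)" using E R(1) by (rule linear_compose)
    fix x y assume "\<forall>k\<in>I. G k \<bullet> y = d k + e k \<bullet> x"
    then have "T y = E x + \<tau>"
      by (auto simp: T_def E_def \<tau>_def vec_eq_iff)
    then have "R (T y) = R (E x) + R \<tau>" using R(1) by (simp add: linear_add)
    then show "y = (R \<circ> E) x + R \<tau>" using R(2) by (metis comp_apply id_apply)
  qed
qed

text \<open>
The function \<open>f\<close> is characterised as the maximum only for parameters in \<open>X\<close>; its values elsewhere are
arbitrary, so derivatives are meaningful only at interior points of \<open>X\<close>.
\<close>

locale parametric_fractional_program =
  fixes G e :: "'i::finite \<Rightarrow> 'a::euclidean_space" and d :: "'i \<Rightarrow> real"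
    and a c :: 'a and g h :: real and X :: "'a set" and f :: "'a \<Rightarrow> real"
    and Q :: "'a \<Rightarrow> 'a set"
  assumes feasible_iff: "y \<in> Q x \<longleftrightarrow> (\<forall>k. G k \<bullet> y \<le> d k + e k \<bullet> x)"
    and compact_Q: "x \<in> X \<Longrightarrow> compact (Q x)"
    and denominator_pos: "x \<in> X \<Longrightarrow> y \<in> Q x \<Longrightarrow> 0 < c \<bullet> y + h"
    and value_attained: "x \<in> X \<Longrightarrow> \<exists>y\<in>Q x. (a \<bullet> y + g) / (c \<bullet> y + h) = f x"
    and value_upper: "x \<in> X \<Longrightarrow> y \<in> Q x \<Longrightarrow> (a \<bullet> y + g) / (c \<bullet> y + h) \<le> f x"
begin

text \<open>
Optimality is written with the denominator cleared, which makes it a linear equation in \<open>y\<close>: this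
exhibits the optimal set as a face of \<open>Q x\<close>.
\<close>

definition optimal_set :: "'a \<Rightarrow> 'a set" where
  "optimal_set x = {y \<in> Q x. a \<bullet> y + g = f x * (c \<bullet> y + h)}"

lemma numerator_le:
  assumes "x \<in> X" "y \<in> Q x"
  shows "a \<bullet> y + g \<le> f x * (c \<bullet> y + h)"
  using denominator_pos[OF assms] value_upper[OF assms] by (simp add: field_simps)

lemma optimal_set_alt:
  assumes "x \<in> X"
  shows "optimal_set x = {y \<in> Q x. (a \<bullet> y + g) / (c \<bullet> y + h) = f x}"
  using denominator_pos[OF assms] unfolding optimal_set_def by (fastforce simp: field_simps)

lemma optimal_set_facts:
  assumes "x \<in> X"
  shows "compact (optimal_set x)" "convex (optimal_set x)" "optimal_set x \<noteq> {}"
proof -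
  have O: "optimal_set x = Q x \<inter> {y. (a - f x *\<^sub>R c) \<bullet> y = f x * h - g}"
    unfolding optimal_set_def by (auto simp: inner_diff_left algebra_simps)
  have "Q x = (\<Inter>k. {y. G k \<bullet> y \<le> d k + e k \<bullet> x})" by (auto simp: feasible_iff)
  then have "convex (Q x)" by (auto intro: convex_INT convex_halfspace_le)
  then show "convex (optimal_set x)" unfolding O by (intro convex_Int convex_hyperplane)
  show "compact (optimal_set x)" unfolding O
    using compact_Q[OF assms] closed_hyperplane by (rule compact_Int_closed)
  show "optimal_set x \<noteq> {}" unfolding optimal_set_alt[OF assms] using value_attained[OF assms] by auto
qed

text \<open>
If some \<open>v \<noteq> 0\<close> were orthogonal to all active normals, one could move from \<open>y\<close> a little along both
\<open>v\<close> and \<open>-v\<close> inside \<open>Q x\<close>. The linear function \<open>a \<bullet> y + g - f x * (c \<bullet> y + h)\<close> is nonpositive on \<open>Q x\<close>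
and zero at \<open>y\<close>, so it vanishes at both new points, which are then optimal and have \<open>y\<close> as midpoint.
\<close>

lemma extreme_optimum_determined:
  assumes x: "x \<in> X" and y: "y extreme_point_of optimal_set x"
    and v: "\<forall>k \<in> {k. G k \<bullet> y = d k + e k \<bullet> x}. G k \<bullet> v = 0"
  shows "v = 0"
proof (rule ccontr)
  assume vnz: "v \<noteq> 0"
  have yO: "y \<in> optimal_set x" using y by (simp add: extreme_point_of_def)
  then have yQ: "y \<in> Q x" and yopt: "a \<bullet> y + g = f x * (c \<bullet> y + h)"
    by (auto simp: optimal_set_def)
  have "\<forall>\<^sub>F t in at_right (0::real). \<forall>k. G k \<bullet> (y + t *\<^sub>R v) \<le> d k + e k \<bullet> x \<and>
      G k \<bullet> (y - t *\<^sub>R v) \<le> d k + e k \<bullet> x"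
  proof (rule eventually_all_finite)
    fix k
    show "\<forall>\<^sub>F t in at_right (0::real). G k \<bullet> (y + t *\<^sub>R v) \<le> d k + e k \<bullet> x \<and>
        G k \<bullet> (y - t *\<^sub>R v) \<le> d k + e k \<bullet> x"
    proof (cases "G k \<bullet> y = d k + e k \<bullet> x")
      case True
      then have "G k \<bullet> v = 0" using v by auto
      then show ?thesis using True by (simp add: inner_add_right inner_diff_right)
    next
      case False
      then have lt: "G k \<bullet> y < d k + e k \<bullet> x" using yQ by (auto simp: feasible_iff less_le)
      have "((\<lambda>t. G k \<bullet> (y + t *\<^sub>R v)) \<longlongrightarrow> G k \<bullet> (y + 0 *\<^sub>R v)) (at_right (0::real))"
        "((\<lambda>t. G k \<bullet> (y - t *\<^sub>R v)) \<longlongrightarrow> G k \<bullet> (y - 0 *\<^sub>R v)) (at_right (0::real))"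
        by (intro tendsto_intros)+
      from order_tendstoD(2)[OF this(1), of "d k + e k \<bullet> x"] order_tendstoD(2)[OF this(2), of "d k + e k \<bullet> x"] lt
      have "\<forall>\<^sub>F t in at_right (0::real). G k \<bullet> (y + t *\<^sub>R v) < d k + e k \<bullet> x"
        "\<forall>\<^sub>F t in at_right (0::real). G k \<bullet> (y - t *\<^sub>R v) < d k + e k \<bullet> x" by auto
      then show ?thesis by eventually_elim auto
    qed
  qed
  moreover have "\<forall>\<^sub>F t in at_right (0::real). t > 0" by (rule eventually_at_right_less)
  ultimately have "\<forall>\<^sub>F t in at_right (0::real). t > 0 \<and> y + t *\<^sub>R v \<in> Q x \<and> y - t *\<^sub>R v \<in> Q x"
    by eventually_elim (auto simp: feasible_iff)
  then obtain t :: real where t: "t > 0" and plus: "y + t *\<^sub>R v \<in> Q x" and minus: "y - t *\<^sub>R v \<in> Q x"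
    using eventually_happens[of _ "at_right (0::real)"] by (auto simp: trivial_limit_at_right_real)
  have "t * (a \<bullet> v) = t * (f x * (c \<bullet> v))"
    using numerator_le[OF x plus] numerator_le[OF x minus] yopt
    by (intro antisym) (simp_all add: inner_add_right inner_diff_right algebra_simps)
  then have "a \<bullet> v = f x * (c \<bullet> v)" using t by simp
  then have "y + t *\<^sub>R v \<in> optimal_set x" "y - t *\<^sub>R v \<in> optimal_set x"
    using yopt plus minus
    by (simp_all add: optimal_set_def inner_add_right inner_diff_right algebra_simps)
  moreover have "y \<in> open_segment (y + t *\<^sub>R v) (y - t *\<^sub>R v)"
  proof -
    have "y = midpoint (y + t *\<^sub>R v) (y - t *\<^sub>R v)"
      by (simp add: midpoint_def scaleR_2[symmetric])
    moreover have "y + t *\<^sub>R v \<noteq> y - t *\<^sub>R v"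
    proof
      assume "y + t *\<^sub>R v = y - t *\<^sub>R v"
      then have "(2 * t) *\<^sub>R v = 0" by (simp add: algebra_simps scaleR_2[symmetric] flip: scaleR_scaleR)
      with t vnz show False by simp
    qed
    ultimately show ?thesis using midpoint_in_open_segment by metis
  qed
  ultimately show False using y unfolding extreme_point_of_def by blast
qed

text \<open>
One affine map for each set of constraints that determines its solution; the active set of an
extreme optimum is such a set.
\<close>

lemma finite_affine_family:
  obtains V :: "('a \<Rightarrow> 'a) set" where "finite V"
    "\<And>F. F \<in> V \<Longrightarrow> \<exists>L t. linear L \<and> F = (\<lambda>x. L x + t)"
    "\<And>x y. x \<in> X \<Longrightarrow> y extreme_point_of optimal_set x \<Longrightarrow> \<exists>F\<in>V. y = F x"
proof -
  let ?det = "\<lambda>I. \<forall>v. (\<forall>k\<in>I. G k \<bullet> v = 0) \<longrightarrow> v = 0"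
  let ?sol = "\<lambda>I F. (\<exists>L t. linear L \<and> F = (\<lambda>x. L x + t)) \<and>
      (\<forall>x y. (\<forall>k\<in>I. G k \<bullet> y = d k + e k \<bullet> x) \<longrightarrow> y = F x)"
  have "\<forall>I\<in>{I. ?det I}. \<exists>F. ?sol I F"
  proof
    fix I assume "I \<in> {I. ?det I}"
    then obtain L t where "linear L" "\<And>x y. \<forall>k\<in>I. G k \<bullet> y = d k + e k \<bullet> x \<Longrightarrow> y = L x + t"
      using determined_solution_affine[of I G d e] by blast
    then show "\<exists>F. ?sol I F" by (intro exI[of _ "\<lambda>x. L x + t"]) blast
  qed
  from bchoice[OF this] obtain F where "\<forall>I\<in>{I. ?det I}. ?sol I (F I)" ..
  then have F: "?sol I (F I)" if "?det I" for I using that by blast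
  show thesis
  proof (rule that[of "F ` {I. ?det I}"])
    show "finite (F ` {I. ?det I})" by simp
    show "\<exists>L t. linear L \<and> \<phi> = (\<lambda>x. L x + t)" if "\<phi> \<in> F ` {I. ?det I}" for \<phi>
      using that F by blast
    fix x y assume x: "x \<in> X" and y: "y extreme_point_of optimal_set x"
    let ?I = "{k. G k \<bullet> y = d k + e k \<bullet> x}"
    have "?det ?I" using extreme_optimum_determined[OF x y] by blast
    then show "\<exists>\<phi>\<in>F ` {I. ?det I}. y = \<phi> x" using F[of ?I] by blast
  qed
qed

text \<open>
The vector \<open>p\<close> is any rate in a sensitivity inequality at \<open>x\<close>; in the application it comes from dual
multipliers. The exceptional set \<open>N\<close> is independent of \<open>z\<close> and \<open>p\<close>, since it is built from the affine
family alone.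
\<close>

theorem gradient_almost_everywhere:
  obtains N where "negligible N"
    "\<And>x z p. x \<in> interior X - N \<Longrightarrow> z \<in> optimal_set x \<Longrightarrow>
       (\<And>x' y. x' \<in> X \<Longrightarrow> y \<in> Q x' \<Longrightarrow> a \<bullet> y + g - f x * (c \<bullet> y + h) \<le> p \<bullet> (x' - x)) \<Longrightarrow>
       GDERIV f x :> p /\<^sub>R (c \<bullet> z + h)"
proof -
  obtain V :: "('a \<Rightarrow> 'a) set" where V: "finite V"
    "\<And>F. F \<in> V \<Longrightarrow> \<exists>L t. linear L \<and> F = (\<lambda>x. L x + t)"
    "\<And>x y. x \<in> X \<Longrightarrow> y extreme_point_of optimal_set x \<Longrightarrow> \<exists>F\<in>V. y = F x"
    by (rule finite_affine_family) blast
  let ?num = "\<lambda>(F :: 'a \<Rightarrow> 'a) x. a \<bullet> F x + g" and ?den = "\<lambda>(F :: 'a \<Rightarrow> 'a) x. c \<bullet> F x + h"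
  \<comment> \<open>Parameters at which \<open>F\<close> touches a constraint without running along it.\<close>
  define accidental where "accidental = (\<lambda>F k. if \<forall>x. G k \<bullet> F x = d k + e k \<bullet> x then {}
    else {x. G k \<bullet> F x = d k + e k \<bullet> x})"
  \<comment> \<open>Parameters at which the fractions along \<open>F\<close> and \<open>F'\<close> meet transversally, with denominators cleared.\<close>
  define crossing where "crossing = (\<lambda>(F :: 'a \<Rightarrow> 'a) (F' :: 'a \<Rightarrow> 'a). {x. ?num F x * ?den F' x - ?num F' x * ?den F x = 0 \<and>
     (\<exists>D. ((\<lambda>x. ?num F x * ?den F' x - ?num F' x * ?den F x) has_derivative D) (at x) \<and> D \<noteq> (\<lambda>_. 0))})"
  define N where "N = (\<Union>F\<in>V. \<Union>k. accidental F k) \<union> (\<Union>F\<in>V. \<Union>F'\<in>V. crossing F F')"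
  have "negligible (accidental F k)" if F: "F \<in> V" for F k
  proof -
    obtain L t where L: "linear L" and F_def: "F = (\<lambda>x. L x + t)" using V(2)[OF F] by auto
    have *: "G k \<bullet> F x = d k + e k \<bullet> x \<longleftrightarrow> (adjoint L (G k) - e k) \<bullet> x = d k - G k \<bullet> t" for x
    proof -
      have "(adjoint L (G k) - e k) \<bullet> x = G k \<bullet> L x - e k \<bullet> x"
        using adjoint_works[OF L, of x "G k"] by (simp add: inner_diff_left inner_commute inner_diff_right)
      then show ?thesis unfolding F_def inner_add_right by linarith
    qed
    show ?thesis
    proof (cases "adjoint L (G k) - e k = 0 \<and> d k - G k \<bullet> t = 0")
      case True
      then have "\<forall>x. G k \<bullet> F x = d k + e k \<bullet> x" unfolding * by simp
      then show ?thesis by (simp add: accidental_def)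
    next
      case False
      then have "negligible {x. (adjoint L (G k) - e k) \<bullet> x = d k - G k \<bullet> t}"
        by (intro negligible_hyperplane) auto
      then have "negligible {x. G k \<bullet> F x = d k + e k \<bullet> x}" unfolding * .
      then show ?thesis by (simp add: accidental_def)
    qed
  qed
  moreover have "negligible (crossing F F')" for F F'
    unfolding crossing_def by (rule negligible_regular_zero_set)
  ultimately have "negligible N"
    unfolding N_def using V(1) by (intro negligible_Un negligible_Union) auto
  then show thesis
  proof (rule that)
    fix x z p
    assume x: "x \<in> interior X - N" and z: "z \<in> optimal_set x"
      and p: "\<And>x' y. x' \<in> X \<Longrightarrow> y \<in> Q x' \<Longrightarrow> a \<bullet> y + g - f x * (c \<bullet> y + h) \<le> p \<bullet> (x' - x)"
    have xX: "x \<in> X" using x interior_subset by auto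
    have evX: "\<forall>\<^sub>F x' in nhds x. x' \<in> X"
      using x eventually_nhds_in_open[of "interior X" x] interior_subset[of X]
      by (auto elim: eventually_mono)
    \<comment> \<open>The affine maps that are optimal at \<open>x\<close>.\<close>
    define W where "W = {F \<in> V. F x \<in> optimal_set x}"
    have W: "finite W" "\<And>F. F \<in> W \<Longrightarrow> F \<in> V" "\<And>F. F \<in> W \<Longrightarrow> F x \<in> Q x"
      "\<And>F. F \<in> W \<Longrightarrow> ?num F x = f x * ?den F x"
      using V(1) by (auto simp: W_def optimal_set_def)
    have den_pos: "0 < ?den F x" if "F \<in> V" "F x \<in> Q x" for F
      using that denominator_pos[OF xX] by blast
    have deriv: "\<exists>L. linear L \<and> (F has_derivative L) (at x)" if F: "F \<in> V" for F
    proof -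
      obtain L t where L: "linear L" and F_def: "F = (\<lambda>x. L x + t)" using V(2)[OF F] by auto
      have "bounded_linear L" using L by (simp add: linear_conv_bounded_linear)
      then have "((\<lambda>x. L x + t) has_derivative L) (at x)"
        by (auto intro!: derivative_eq_intros bounded_linear_imp_has_derivative)
      with L show ?thesis by (auto simp: F_def)
    qed
    have lim: "(F \<longlongrightarrow> F x) (nhds x)" if "F \<in> V" for F
    proof -
      have "isCont F x" using deriv[OF that] has_derivative_continuous by blast
      then show ?thesis by (simp add: isCont_def tendsto_at_iff_tendsto_nhds)
    qed
    have ident: "((\<lambda>x'. x') \<longlongrightarrow> x) (nhds x)" by (simp add: filterlim_ident)
    have stay: "\<forall>\<^sub>F x' in nhds x. F x' \<in> Q x'" if F: "F \<in> V" and FQ: "F x \<in> Q x" for F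
    proof -
      have "\<forall>\<^sub>F x' in nhds x. \<forall>k. G k \<bullet> F x' \<le> d k + e k \<bullet> x'"
      proof (rule eventually_all_finite)
        fix k
        have "x \<notin> accidental F k" using x F by (auto simp: N_def)
        then consider "\<forall>x'. G k \<bullet> F x' = d k + e k \<bullet> x'" | "G k \<bullet> F x \<noteq> d k + e k \<bullet> x"
          by (auto simp: accidental_def split: if_splits)
        then show "\<forall>\<^sub>F x' in nhds x. G k \<bullet> F x' \<le> d k + e k \<bullet> x'"
        proof cases
          case 2
          then have "G k \<bullet> F x < d k + e k \<bullet> x" using FQ by (auto simp: feasible_iff less_le)
          then have "G k \<bullet> F x - e k \<bullet> x < d k" by simp
          moreover have "((\<lambda>x'. G k \<bullet> F x' - e k \<bullet> x') \<longlongrightarrow> G k \<bullet> F x - e k \<bullet> x) (nhds x)"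
            by (intro tendsto_intros lim F ident)
          ultimately have "\<forall>\<^sub>F x' in nhds x. G k \<bullet> F x' - e k \<bullet> x' < d k"
            by (rule order_tendstoD(2)[rotated])
          then show ?thesis by eventually_elim simp
        qed simp
      qed
      then show ?thesis by (simp add: feasible_iff)
    qed
    have leave: "\<forall>\<^sub>F x' in nhds x. F x' \<notin> Q x'" if F: "F \<in> V" and FQ: "F x \<notin> Q x" for F
    proof -
      obtain k where "G k \<bullet> F x > d k + e k \<bullet> x" using FQ by (auto simp: feasible_iff not_le)
      then have "G k \<bullet> F x - e k \<bullet> x > d k" by simp
      moreover have "((\<lambda>x'. G k \<bullet> F x' - e k \<bullet> x') \<longlongrightarrow> G k \<bullet> F x - e k \<bullet> x) (nhds x)"
        by (intro tendsto_intros lim F ident)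
      ultimately have "\<forall>\<^sub>F x' in nhds x. G k \<bullet> F x' - e k \<bullet> x' > d k"
        by (rule order_tendstoD(1)[rotated])
      then show ?thesis
      proof eventually_elim
        case (elim x')
        then have "\<not> G k \<bullet> F x' \<le> d k + e k \<bullet> x'" by simp
        then show ?case unfolding feasible_iff by blast
      qed
    qed
    \<comment> \<open>Along an optimal \<open>F\<close> both sides of the sensitivity inequality are affine in \<open>x'\<close> and vanish
       at \<open>x\<close>, so the inequality near \<open>x\<close> forces their linear parts to agree.\<close>
    have gain: "?num F x' = f x * ?den F x' + p \<bullet> (x' - x)" if F: "F \<in> W" for F x'
    proof -
      obtain L t where L: "linear L" and F_def: "F = (\<lambda>x. L x + t)" using V(2) W(2)[OF F] by blast
      define q where "q = adjoint L (a - f x *\<^sub>R c)"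
      have q: "?num F y - f x * ?den F y = q \<bullet> (y - x)" for y
      proof -
        have "q \<bullet> (y - x) = (a - f x *\<^sub>R c) \<bullet> (F y - F x)"
          using adjoint_works[OF L, of "y - x" "a - f x *\<^sub>R c"] L
          by (simp add: q_def F_def inner_commute linear_diff)
        then show ?thesis using W(4)[OF F]
          by (simp add: inner_diff_left inner_diff_right algebra_simps)
      qed
      have "\<forall>\<^sub>F y in nhds x. (q - p) \<bullet> (y - x) \<le> 0"
        using evX stay[OF W(2)[OF F] W(3)[OF F]]
      proof eventually_elim
        case (elim y)
        then show ?case using p[of y "F y"] q[of y] by (simp add: inner_diff_left)
      qed
      then have "q = p" using eventually_inner_nonpos_imp_zero by force
      then show ?thesis using q[of x'] by simp
    qed
    have extreme: "\<exists>F\<in>W. y = F x" if "y extreme_point_of optimal_set x" for y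
      using V(3)[OF xX that] that by (auto simp: W_def extreme_point_of_def)
    obtain F0 where F0: "F0 \<in> W"
      using extreme_point_exists_convex[OF optimal_set_facts[OF xX]] extreme by blast
    \<comment> \<open>A map that is feasible but not optimal at \<open>x\<close> stays strictly worse than the feasible
       competitor \<open>F0\<close> nearby.\<close>
    have drop: "\<forall>\<^sub>F x' in nhds x. F x' \<notin> optimal_set x'" if F: "F \<in> V - W" for F
    proof (cases "F x \<in> Q x")
      case False
      then show ?thesis
        using leave[of F] F by (auto elim!: eventually_mono simp: optimal_set_def)
    next
      case True
      have "?num F x < f x * ?den F x"
        using F True numerator_le[OF xX True] by (auto simp: W_def optimal_set_def less_le)
      then have lt: "?num F x / ?den F x < f x"
        using den_pos[of F] F True by (simp add: field_simps)
      have eq: "?num F0 x / ?den F0 x = f x"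
        using den_pos[of F0] W(2-4)[OF F0] by (simp add: field_simps)
      have "((\<lambda>x'. ?num F x' / ?den F x' - ?num F0 x' / ?den F0 x') \<longlongrightarrow>
          ?num F x / ?den F x - ?num F0 x / ?den F0 x) (nhds x)"
        using den_pos[of F] F True den_pos[of F0] W(2,3)[OF F0]
        by (intro tendsto_intros lim) auto
      then have "\<forall>\<^sub>F x' in nhds x. ?num F x' / ?den F x' - ?num F0 x' / ?den F0 x' < 0"
        by (rule order_tendstoD(2)) (use lt eq in simp)
      then show ?thesis using evX stay[OF W(2)[OF F0] W(3)[OF F0]]
      proof eventually_elim
        case (elim x')
        then show ?case using value_upper[of x' "F0 x'"] by (auto simp: optimal_set_alt)
      qed
    qed
    have "\<forall>\<^sub>F x' in nhds x. \<forall>F\<in>V - W. F x' \<notin> optimal_set x'"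
      using V(1) drop by (intro eventually_ball_finite) auto
    then have selection: "\<forall>\<^sub>F x' in nhds x. \<exists>F\<in>W. f x' = f x + p \<bullet> (x' - x) / ?den F x'"
      using evX
    proof eventually_elim
      case (elim x')
      then obtain y where y: "y extreme_point_of optimal_set x'"
        using extreme_point_exists_convex[OF optimal_set_facts] by blast
      then have yO: "y \<in> optimal_set x'" by (simp add: extreme_point_of_def)
      obtain F where F: "F \<in> V" "y = F x'" using V(3) y elim by blast
      then have FW: "F \<in> W" using elim yO by blast
      have "F x' \<in> Q x'" "?num F x' = f x' * ?den F x'" using yO F by (auto simp: optimal_set_def)
      moreover from this have "0 < ?den F x'" using denominator_pos elim by blast
      ultimately have "f x' = f x + p \<bullet> (x' - x) / ?den F x'"
        using gain[OF FW, of x'] by (simp add: field_simps)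
      with FW show ?case by blast
    qed
    have den_eq: "?den F x = c \<bullet> z + h" if pnz: "p \<noteq> 0" and F: "F \<in> W" for F
    proof -
      have same: "?den F' x = ?den F x" if F': "F' \<in> W" for F'
      proof (rule ccontr)
        assume ne: "?den F' x \<noteq> ?den F x"
        obtain L L' where L: "(F has_derivative L) (at x)" "(F' has_derivative L') (at x)"
          using deriv W(2) F F' by metis
        let ?R = "\<lambda>x'. ?den F' x' - ?den F x'"
        have R: "(?R has_derivative (\<lambda>v. c \<bullet> L' v - c \<bullet> L v)) (at x)"
          by (auto intro!: derivative_eq_intros L)
        have "((\<lambda>x'. p \<bullet> (x' - x)) has_derivative (\<lambda>v. p \<bullet> v)) (at x)"
          by (auto intro!: derivative_eq_intros)
        from has_derivative_mult[OF this R]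
        have D: "((\<lambda>x'. p \<bullet> (x' - x) * ?R x') has_derivative (\<lambda>v. p \<bullet> v * ?R x)) (at x)" by simp
        \<comment> \<open>Substituting \<open>gain\<close> for both numerators cancels the products of the denominators.\<close>
        have H: "?num F x' * ?den F' x' - ?num F' x' * ?den F x' = p \<bullet> (x' - x) * ?R x'" for x'
          unfolding gain[OF F, of x'] gain[OF F', of x'] by (simp add: algebra_simps)
        have "(\<lambda>v. p \<bullet> v * ?R x) \<noteq> (\<lambda>_. 0)"
          using pnz ne by (metis (mono_tags) eq_iff_diff_eq_0 inner_eq_zero_iff mult_eq_0_iff)
        then have "x \<in> crossing F F'"
          unfolding crossing_def H using D by auto
        then show False using x W(2) F F' by (auto simp: N_def)
      qed
      have "{y. y extreme_point_of optimal_set x} \<subseteq> {y. c \<bullet> y = ?den F x - h}"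
        using extreme same by fastforce
      then have "convex hull {y. y extreme_point_of optimal_set x} \<subseteq> {y. c \<bullet> y = ?den F x - h}"
        by (rule hull_minimal) (rule convex_hyperplane)
      then show ?thesis
        using z Krein_Milman_Minkowski[OF optimal_set_facts(1,2)[OF xX]] by auto
    qed
    let ?\<phi> = "\<lambda>F x'. f x + p \<bullet> (x' - x) / ?den F x'"
    have "(f has_derivative (\<lambda>v. v \<bullet> (p /\<^sub>R (c \<bullet> z + h)))) (at x)"
    proof (rule has_derivative_finite_selection)
      show "finite (?\<phi> ` W)" using W(1) by simp
      show "\<forall>\<^sub>F x' in nhds x. \<exists>\<phi>\<in>?\<phi> ` W. f x' = \<phi> x'" using selection by simp
      fix \<phi> assume "\<phi> \<in> ?\<phi> ` W"
      then obtain F where F: "F \<in> W" and \<phi>: "\<phi> = ?\<phi> F" by auto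
      obtain L where L: "(F has_derivative L) (at x)" using deriv W(2)[OF F] by blast
      have nz: "?den F x \<noteq> 0" using den_pos W(2,3)[OF F] by force
      have "((\<lambda>x'. p \<bullet> (x' - x)) has_derivative (\<lambda>v. p \<bullet> v)) (at x)"
        "(?den F has_derivative (\<lambda>v. c \<bullet> L v)) (at x)"
        by (auto intro!: derivative_eq_intros L)
      from has_derivative_divide'[OF this nz] nz
      have "((\<lambda>x'. p \<bullet> (x' - x) / ?den F x') has_derivative (\<lambda>v. p \<bullet> v / ?den F x)) (at x)" by simp
      from has_derivative_add[OF has_derivative_const[of "f x"] this]
      have "(\<phi> has_derivative (\<lambda>v. p \<bullet> v / ?den F x)) (at x)" by (simp add: \<phi>)
      moreover have "(\<lambda>v. p \<bullet> v / ?den F x) = (\<lambda>v. v \<bullet> (p /\<^sub>R (c \<bullet> z + h)))"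
        using den_eq[OF _ F] by (cases "p = 0") (auto simp: fun_eq_iff inner_commute divide_inverse mult.commute)
      ultimately show "(\<phi> has_derivative (\<lambda>v. v \<bullet> (p /\<^sub>R (c \<bullet> z + h)))) (at x) \<and> \<phi> x = f x"
        by (simp add: \<phi>)
    qed
    then show "GDERIV f x :> p /\<^sub>R (c \<bullet> z + h)" by (simp add: gderiv_def inner_commute)
  qed
qed

end

section \<open>Weighted balls intersected with a polytope, and linear programming duality\<close>
text \<open>
The vectors \<open>sign_weight w \<sigma>\<close> are the outer normals of the weighted \<open>l\<^sub>1\<close> ball, that is, the vertices
of the dual ball; \<open>\<sigma>\<close> is the set of coordinates with a plus sign.
\<close>

definition sign_weight :: "real^'n \<Rightarrow> 'n set \<Rightarrow> real^'n" where
  "sign_weight w \<sigma> = (\<chi> j. if j \<in> \<sigma> then w $ j else - w $ j)"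

lemma wnorm_le_iff_sign_weight:
  assumes "\<And>j. 0 \<le> w $ j"
  shows "wnorm w y \<le> \<delta> \<longleftrightarrow> (\<forall>\<sigma>. sign_weight w \<sigma> \<bullet> y \<le> \<delta>)"
proof
  have "sign_weight w \<sigma> \<bullet> y \<le> wnorm w y" for \<sigma>
    unfolding wnorm_def inner_vec_def sign_weight_def
  proof (rule sum_mono)
    fix j
    have "w $ j * y $ j \<le> w $ j * \<bar>y $ j\<bar>" "w $ j * (- y $ j) \<le> w $ j * \<bar>y $ j\<bar>"
      using assms by (intro mult_left_mono; simp)+
    then show "(\<chi> j. if j \<in> \<sigma> then w $ j else - w $ j) $ j \<bullet> y $ j \<le> w $ j * \<bar>y $ j\<bar>" by simp
  qed
  then show "wnorm w y \<le> \<delta> \<Longrightarrow> \<forall>\<sigma>. sign_weight w \<sigma> \<bullet> y \<le> \<delta>" by (meson order_trans)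
next
  assume "\<forall>\<sigma>. sign_weight w \<sigma> \<bullet> y \<le> \<delta>"
  then have "sign_weight w {j. 0 \<le> y $ j} \<bullet> y \<le> \<delta>" ..
  moreover have "sign_weight w {j. 0 \<le> y $ j} \<bullet> y = wnorm w y"
    unfolding wnorm_def inner_vec_def sign_weight_def by (intro sum.cong) auto
  ultimately show "wnorm w y \<le> \<delta>" by simp
qed

lemma poly_set_iff: "y \<in> poly_set A b \<longleftrightarrow> (\<forall>k. A $ k \<bullet> y \<le> b $ k)"
  by (simp add: poly_set_def less_eq_vec_def matrix_vector_mul_component)

lemma poly_set_eq_INT: "poly_set A b = (\<Inter>k. {y. A $ k \<bullet> y \<le> b $ k})"
  by (auto simp: poly_set_iff)

lemma convex_poly_set: "convex (poly_set A b)"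
  unfolding poly_set_eq_INT by (intro convex_INT convex_halfspace_le)

lemma closed_poly_set: "closed (poly_set A b)"
  unfolding poly_set_eq_INT by (intro closed_INT ballI closed_halfspace_le)

lemma transpose_mult_inner: "(transpose A *v l) \<bullet> y = l \<bullet> (A *v y)"
  for A :: "real^'n^'k"
  by (metis dot_lmul_matrix vector_transpose_matrix transpose_transpose)

text \<open>
Weak duality with the dual point taken at \<open>x\<close> and the competitor at another centre \<open>x'\<close>. In \<open>P_i(x)\<close> the
centre enters only through the terms \<open>\<theta> x\<close>, whose multiplier is \<open>\<pi>1 - \<pi>2\<close>, so moving the centre
shifts the weak duality bound by \<open>(\<pi>1 - \<pi>2) \<bullet> (x' - x)\<close>. The distance constraint uses \<open>\<bar>\<pi>1 - \<pi>2\<bar> \<le> \<pi>1 + \<pi>2 = \<gamma> w\<close> componentwise.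
\<close>

lemma dual_feasible_imp_numerator_le:
  assumes dual: "dual_feasible A b w \<delta> a g c h x \<pi>1 \<pi>2 \<gamma> \<tau> l \<kappa>"
    and y: "wnorm w (y - x') \<le> \<delta>" "y \<in> poly_set A b"
  shows "a \<bullet> y + g - \<tau> * (c \<bullet> y + h) \<le> (\<pi>1 - \<pi>2) \<bullet> (x' - x)"
proof -
  let ?p = "\<pi>1 - \<pi>2"
  have eqs: "a = ?p + \<tau> *\<^sub>R c + transpose A *v l"
    "g = - (x \<bullet> \<pi>1) + x \<bullet> \<pi>2 - \<delta> * \<gamma> + h * \<tau> - b \<bullet> l - \<kappa>"
    and sum: "\<pi>1 + \<pi>2 = \<gamma> *\<^sub>R w"
    and pos: "0 \<le> \<pi>1" "0 \<le> \<pi>2" "0 \<le> \<gamma>" "0 \<le> l" "0 \<le> \<kappa>"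
    using dual unfolding dual_feasible_def by (auto simp: algebra_simps)
  have "?p \<bullet> (y - x') \<le> (\<Sum>j\<in>UNIV. \<gamma> * (w $ j * \<bar>(y - x') $ j\<bar>))"
    unfolding inner_vec_def
  proof (rule sum_mono)
    fix j
    have nn: "0 \<le> \<pi>1 $ j" "0 \<le> \<pi>2 $ j" using pos by (auto simp: less_eq_vec_def)
    have "?p $ j \<bullet> (y - x') $ j \<le> \<bar>?p $ j\<bar> * \<bar>(y - x') $ j\<bar>"
      by (simp only: inner_real_def abs_ge_self flip: abs_mult)
    also have "\<dots> \<le> (\<pi>1 + \<pi>2) $ j * \<bar>(y - x') $ j\<bar>"
      using nn by (intro mult_right_mono) auto
    finally show "?p $ j \<bullet> (y - x') $ j \<le> \<gamma> * (w $ j * \<bar>(y - x') $ j\<bar>)"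
      by (simp add: sum)
  qed
  also have "\<dots> = \<gamma> * wnorm w (y - x')" by (simp add: wnorm_def sum_distrib_left)
  also have "\<dots> \<le> \<gamma> * \<delta>" using y pos by (intro mult_left_mono) auto
  finally have ball: "?p \<bullet> (y - x') \<le> \<gamma> * \<delta>" .
  have "0 \<le> l \<bullet> (b - A *v y)"
    using pos y(2) by (auto simp: inner_vec_def poly_set_def less_eq_vec_def intro!: sum_nonneg)
  then have cons: "(transpose A *v l) \<bullet> y \<le> b \<bullet> l"
    unfolding transpose_mult_inner by (simp add: inner_diff_right inner_commute)
  have "a \<bullet> y + g - \<tau> * (c \<bullet> y + h)
      = ?p \<bullet> (x' - x) + (?p \<bullet> (y - x') - \<gamma> * \<delta>) + ((transpose A *v l) \<bullet> y - b \<bullet> l) - \<kappa>"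
    unfolding eqs by (simp add: inner_add_left inner_diff_left inner_diff_right inner_commute algebra_simps)
  also have "\<dots> \<le> ?p \<bullet> (x' - x)" using ball cons pos by simp
  finally show ?thesis .
qed

locale neighbourhood_fractional_maximum =
  fixes A :: "real^'n^'k" and b :: "real^'k" and w :: "real^'n" and \<delta> :: real
    and a c :: "real^'n" and g h :: real
  assumes compact_S: "compact (poly_set A b)"
    and denom_pos: "\<And>y. y \<in> poly_set A b \<Longrightarrow> 0 < c \<bullet> y + h"
    and w_pos: "\<And>j. 0 < w $ j"
    and \<delta>_pos: "0 < \<delta>"
begin

definition region :: "real^'n \<Rightarrow> (real^'n) set" where
  "region x = {y. wnorm w (y - x) \<le> \<delta> \<and> y \<in> poly_set A b}"

abbreviation f :: "real^'n \<Rightarrow> real" where "f \<equiv> ftilde A b w \<delta> a g c h"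

abbreviation ratio :: "real^'n \<Rightarrow> real" where "ratio y \<equiv> (a \<bullet> y + g) / (c \<bullet> y + h)"

abbreviation normals :: "'k + 'n set \<Rightarrow> real^'n" where
  "normals \<equiv> case_sum (\<lambda>k. A $ k) (sign_weight w)"

abbreviation offsets :: "'k + 'n set \<Rightarrow> real" where
  "offsets \<equiv> case_sum (\<lambda>k. b $ k) (\<lambda>_. \<delta>)"

abbreviation centre_normals :: "'k + 'n set \<Rightarrow> real^'n" where
  "centre_normals \<equiv> case_sum (\<lambda>_. 0) (sign_weight w)"

lemma region_iff: "y \<in> region x \<longleftrightarrow> (\<forall>k. normals k \<bullet> y \<le> offsets k + centre_normals k \<bullet> x)"
proof -
  have "wnorm w (y - x) \<le> \<delta> \<longleftrightarrow> (\<forall>\<sigma>. sign_weight w \<sigma> \<bullet> y \<le> \<delta> + sign_weight w \<sigma> \<bullet> x)"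
    by (subst wnorm_le_iff_sign_weight) (auto simp: w_pos less_imp_le algebra_simps)
  then show ?thesis by (auto simp: region_def poly_set_iff split_sum_all)
qed

lemma region_denom_pos: "y \<in> region x \<Longrightarrow> 0 < c \<bullet> y + h"
  by (simp add: region_def denom_pos)

lemma centre_in_region: "x \<in> poly_set A b \<Longrightarrow> x \<in> region x"
  using \<delta>_pos by (simp add: region_def wnorm_def)

lemma compact_region: "compact (region x)"
proof -
  have "closed {y. wnorm w (y - x) \<le> \<delta>}"
    unfolding wnorm_def by (intro closed_Collect_le continuous_intros)
  then have "compact (poly_set A b \<inter> {y. wnorm w (y - x) \<le> \<delta>})"
    using compact_S by (rule compact_Int_closed[rotated])
  then show ?thesis by (simp add: region_def Int_def conj_commute)
qed

lemma ftilde_maximum: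
  assumes "x \<in> poly_set A b"
  shows "\<exists>y\<in>region x. ratio y = f x" and "y \<in> region x \<Longrightarrow> ratio y \<le> f x"
proof -
  have "continuous_on (region x) ratio"
    using region_denom_pos by (intro continuous_intros) force
  then obtain z where z: "z \<in> region x" "\<And>y. y \<in> region x \<Longrightarrow> ratio y \<le> ratio z"
    using continuous_attains_sup[OF compact_region] centre_in_region[OF assms] by blast
  have "f x = ratio z"
    unfolding ftilde_def by (rule Greatest_equality) (use z in \<open>auto simp: region_def\<close>)
  with z show "\<exists>y\<in>region x. ratio y = f x" "y \<in> region x \<Longrightarrow> ratio y \<le> f x" by auto
qed

sublocale parametric_fractional_program normals centre_normals offsets a c g h "poly_set A b" f region
  by unfold_locales (use region_iff compact_region region_denom_pos ftilde_maximum in auto)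

text \<open>
Undoing the homogenisation. The scale \<open>\<theta>\<close> cannot vanish: \<open>\<theta> = 0\<close> would make the distance budget
\<open>\<theta> * \<delta>\<close> zero, hence \<open>y = 0\<close>, against \<open>c \<bullet> y + h * \<theta> = 1\<close>.
\<close>

lemma primal_feasible_imp_region:
  assumes "primal_feasible A b w \<delta> c h x y \<theta> q"
  shows "0 < \<theta>" "y /\<^sub>R \<theta> \<in> region x" "c \<bullet> (y /\<^sub>R \<theta>) + h = 1 / \<theta>"
proof -
  have q: "\<bar>(y - \<theta> *\<^sub>R x) $ j\<bar> \<le> q $ j" for j
    using assms unfolding primal_feasible_def less_eq_vec_def by (auto simp: abs_le_iff algebra_simps)
  have wq: "w \<bullet> q \<le> \<theta> * \<delta>" and norm: "c \<bullet> y + h * \<theta> = 1"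
    and S: "A $ k \<bullet> y \<le> \<theta> * b $ k" and nn: "0 \<le> \<theta>" for k
    using assms unfolding primal_feasible_def less_eq_vec_def by (auto simp: matrix_vector_mul_component)
  have wn: "wnorm w (y - \<theta> *\<^sub>R x) \<le> \<theta> * \<delta>"
  proof -
    have "wnorm w (y - \<theta> *\<^sub>R x) \<le> w \<bullet> q"
      unfolding wnorm_def inner_vec_def inner_real_def
      by (intro sum_mono mult_left_mono q less_imp_le[OF w_pos])
    with wq show ?thesis by simp
  qed
  have "\<theta> \<noteq> 0"
  proof
    assume \<theta>: "\<theta> = 0"
    have "w $ j * \<bar>y $ j\<bar> = 0" for j
    proof -
      have "0 \<le> wnorm w y"
        unfolding wnorm_def by (intro sum_nonneg mult_nonneg_nonneg less_imp_le[OF w_pos] abs_ge_zero)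
      then have "wnorm w y = 0" using wn \<theta> by simp
      then show ?thesis
        unfolding wnorm_def using w_pos by (subst (asm) sum_nonneg_eq_0_iff) (auto simp: less_imp_le)
    qed
    then have "y = 0" using w_pos by (auto simp: vec_eq_iff less_le)
    with norm \<theta> show False by simp
  qed
  with nn show \<theta>: "0 < \<theta>" by simp
  have scale: "wnorm w (y /\<^sub>R \<theta> - x) = wnorm w (y - \<theta> *\<^sub>R x) / \<theta>"
  proof -
    have "\<bar>(y /\<^sub>R \<theta> - x) $ j\<bar> = \<bar>(y - \<theta> *\<^sub>R x) $ j\<bar> / \<theta>" for j
    proof -
      have "(y /\<^sub>R \<theta> - x) $ j = (y - \<theta> *\<^sub>R x) $ j / \<theta>" using \<theta> by (simp add: field_simps)
      then show ?thesis using \<theta> by (simp add: abs_divide)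
    qed
    then show ?thesis unfolding wnorm_def by (simp add: sum_divide_distrib)
  qed
  have "wnorm w (y /\<^sub>R \<theta> - x) \<le> \<delta>" unfolding scale using wn \<theta> by (simp add: divide_le_eq mult.commute)
  moreover have "y /\<^sub>R \<theta> \<in> poly_set A b"
    using S \<theta> by (simp add: poly_set_iff field_simps)
  ultimately show "y /\<^sub>R \<theta> \<in> region x" by (simp add: region_def)
  show "c \<bullet> (y /\<^sub>R \<theta>) + h = 1 / \<theta>" using norm \<theta> by (simp add: field_simps)
qed

lemma region_imp_primal_feasible:
  assumes z: "z \<in> region x"
  defines "\<theta> \<equiv> 1 / (c \<bullet> z + h)"
  shows "primal_feasible A b w \<delta> c h x (\<theta> *\<^sub>R z) \<theta> (\<chi> j. \<theta> * \<bar>(z - x) $ j\<bar>)"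
proof -
  have den: "0 < c \<bullet> z + h" using z by (rule region_denom_pos)
  then have \<theta>: "0 < \<theta>" by (simp add: \<theta>_def)
  have bound: "\<theta> * z $ j - \<theta> * x $ j \<le> \<theta> * \<bar>z $ j - x $ j\<bar>"
    "\<theta> * x $ j - \<theta> * z $ j \<le> \<theta> * \<bar>z $ j - x $ j\<bar>" for j
    using \<theta> by (auto simp flip: right_diff_distrib)
  have "w \<bullet> (\<chi> j. \<theta> * \<bar>(z - x) $ j\<bar>) = \<theta> * wnorm w (z - x)"
    unfolding wnorm_def inner_vec_def sum_distrib_left by (intro sum.cong) auto
  also have "\<dots> \<le> \<theta> * \<delta>" using z \<theta> by (simp add: region_def)
  finally have "w \<bullet> (\<chi> j. \<theta> * \<bar>(z - x) $ j\<bar>) \<le> \<theta> * \<delta>" .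
  moreover have "c \<bullet> (\<theta> *\<^sub>R z) + h * \<theta> = 1"
    using den by (simp add: \<theta>_def flip: add_divide_distrib)
  moreover have "0 \<le> \<theta> *\<^sub>R b - A *v (\<theta> *\<^sub>R z)"
    using z \<theta> by (simp add: region_def poly_set_iff less_eq_vec_def matrix_vector_mul_component)
  ultimately show ?thesis
    using bound \<theta> by (simp add: primal_feasible_def less_eq_vec_def)
qed

lemma primal_objective_eq_ratio:
  assumes "primal_feasible A b w \<delta> c h x y \<theta> q"
  shows "a \<bullet> y + g * \<theta> = ratio (y /\<^sub>R \<theta>)"
  using primal_feasible_imp_region[OF assms] by (simp add: field_simps)

lemma primal_attains_ftilde:
  assumes x: "x \<in> poly_set A b"
  shows "\<exists>y \<theta> q. primal_optimal A b w \<delta> a g c h x y \<theta> q \<and> f x = a \<bullet> y + g * \<theta>"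
proof -
  obtain z where z: "z \<in> region x" "ratio z = f x" using ftilde_maximum(1)[OF x] by blast
  let ?\<theta> = "1 / (c \<bullet> z + h)" and ?q = "\<chi> j. 1 / (c \<bullet> z + h) * \<bar>(z - x) $ j\<bar>"
  have feas: "primal_feasible A b w \<delta> c h x (?\<theta> *\<^sub>R z) ?\<theta> ?q"
    using z(1) by (rule region_imp_primal_feasible)
  have val: "a \<bullet> (?\<theta> *\<^sub>R z) + g * ?\<theta> = f x"
    using z(2) by (simp flip: add_divide_distrib)
  have "a \<bullet> y' + g * \<theta>' \<le> f x" if "primal_feasible A b w \<delta> c h x y' \<theta>' q'" for y' \<theta>' q'
    unfolding primal_objective_eq_ratio[OF that]
    using ftilde_maximum(2)[OF x] primal_feasible_imp_region(2)[OF that] .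
  with feas val show ?thesis unfolding primal_optimal_def by metis
qed

lemma primal_optimal_imp_optimal_set:
  assumes x: "x \<in> poly_set A b" and opt: "primal_optimal A b w \<delta> a g c h x y \<theta> q"
  shows "y /\<^sub>R \<theta> \<in> optimal_set x"
proof -
  have feas: "primal_feasible A b w \<delta> c h x y \<theta> q" using opt by (simp add: primal_optimal_def)
  obtain y' \<theta>' q' where "primal_optimal A b w \<delta> a g c h x y' \<theta>' q'" "f x = a \<bullet> y' + g * \<theta>'"
    using primal_attains_ftilde[OF x] by blast
  then have "a \<bullet> y + g * \<theta> = f x"
    using opt unfolding primal_optimal_def by (metis order_antisym)
  then show ?thesis
    using primal_feasible_imp_region(2)[OF feas]
    by (simp add: optimal_set_alt[OF x] primal_objective_eq_ratio[OF feas])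
qed

text \<open>
Strong duality. Farkas' lemma is applied to \<open>a \<bullet> y + g \<le> f x * (c \<bullet> y + h)\<close> on the region. The multipliers
of the polytope rows give \<open>l\<close>. Those of the sign patterns are sorted by the sign in each coordinate:
plus signs contribute to \<open>\<pi>1\<close>, minus signs to \<open>\<pi>2\<close>, and their total is \<open>\<gamma>\<close>. The slack left over in
the constant term is \<open>\<kappa>\<close>.
\<close>

lemma dual_attains_ftilde:
  assumes x: "x \<in> poly_set A b"
  shows "\<exists>\<pi>1 \<pi>2 \<gamma> l \<kappa>. dual_feasible A b w \<delta> a g c h x \<pi>1 \<pi>2 \<gamma> (f x) l \<kappa>"
proof -
  let ?\<tau> = "f x"
  obtain \<mu> where \<mu>: "\<And>k. 0 \<le> \<mu> k" "a - ?\<tau> *\<^sub>R c = (\<Sum>k\<in>UNIV. \<mu> k *\<^sub>R normals k)"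
    "(\<Sum>k\<in>UNIV. \<mu> k * (offsets k + centre_normals k \<bullet> x)) \<le> ?\<tau> * h - g"
  proof (rule affine_farkas)
    show "\<forall>k. normals k \<bullet> x \<le> offsets k + centre_normals k \<bullet> x"
      using centre_in_region[OF x] region_iff by blast
    fix y assume "\<forall>k. normals k \<bullet> y \<le> offsets k + centre_normals k \<bullet> x"
    then have "y \<in> region x" using region_iff by blast
    from numerator_le[OF x this] show "(a - ?\<tau> *\<^sub>R c) \<bullet> y \<le> ?\<tau> * h - g"
      by (simp add: inner_diff_left algebra_simps)
  qed blast
  define l where "l = (\<chi> k. \<mu> (Inl k))"
  define \<pi>1 where "\<pi>1 = (\<chi> j. \<Sum>\<sigma>\<in>UNIV. \<mu> (Inr \<sigma>) * (if j \<in> \<sigma> then w $ j else 0))"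
  define \<pi>2 where "\<pi>2 = (\<chi> j. \<Sum>\<sigma>\<in>UNIV. \<mu> (Inr \<sigma>) * (if j \<in> \<sigma> then 0 else w $ j))"
  define \<gamma> where "\<gamma> = (\<Sum>\<sigma>\<in>UNIV. \<mu> (Inr \<sigma>))"
  define \<kappa> where "\<kappa> = ?\<tau> * h - g - (\<Sum>k\<in>UNIV. \<mu> k * (offsets k + centre_normals k \<bullet> x))"
  have split: "(\<Sum>k\<in>UNIV. \<phi> k) = (\<Sum>k\<in>UNIV. \<phi> (Inl k)) + (\<Sum>\<sigma>\<in>UNIV. \<phi> (Inr \<sigma>))"
    for \<phi> :: "'k + 'n set \<Rightarrow> 'z::comm_monoid_add"
    by (simp add: UNIV_Plus_UNIV[symmetric] sum.Plus del: UNIV_Plus_UNIV)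
  have p: "\<pi>1 - \<pi>2 = (\<Sum>\<sigma>\<in>UNIV. \<mu> (Inr \<sigma>) *\<^sub>R sign_weight w \<sigma>)"
    by (auto simp: vec_eq_iff \<pi>1_def \<pi>2_def sign_weight_def simp flip: sum_subtractf intro!: sum.cong)
  have s: "\<pi>1 + \<pi>2 = \<gamma> *\<^sub>R w"
    by (auto simp: vec_eq_iff \<pi>1_def \<pi>2_def \<gamma>_def sum_distrib_right simp flip: sum.distrib intro!: sum.cong)
  have At: "transpose A *v l = (\<Sum>k\<in>UNIV. \<mu> (Inl k) *\<^sub>R A $ k)"
    by (auto simp: vec_eq_iff l_def matrix_vector_mult_def transpose_def mult.commute)
  have "a - ?\<tau> *\<^sub>R c = transpose A *v l + (\<pi>1 - \<pi>2)"
    unfolding \<mu>(2) split At p by simp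
  then have 1: "\<pi>1 - \<pi>2 + ?\<tau> *\<^sub>R c + transpose A *v l = a" by (simp add: algebra_simps)
  have "(\<Sum>k\<in>UNIV. \<mu> k * (offsets k + centre_normals k \<bullet> x)) = b \<bullet> l + \<delta> * \<gamma> + (\<pi>1 - \<pi>2) \<bullet> x"
    unfolding split p \<gamma>_def l_def inner_sum_left
    by (simp add: inner_vec_def distrib_left sum.distrib sum_distrib_left mult_ac)
  then have 2: "- (x \<bullet> \<pi>1) + x \<bullet> \<pi>2 - \<delta> * \<gamma> + h * ?\<tau> - b \<bullet> l - \<kappa> = g"
    by (simp add: \<kappa>_def inner_diff_right inner_commute)
  have 3: "- \<pi>1 - \<pi>2 + \<gamma> *\<^sub>R w = 0" using s by (simp add: algebra_simps)
  have "0 \<le> \<pi>1" "0 \<le> \<pi>2" "0 \<le> \<gamma>" "0 \<le> l" "0 \<le> \<kappa>"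
    using \<mu>(1,3) w_pos
    by (auto simp: \<pi>1_def \<pi>2_def \<gamma>_def l_def \<kappa>_def less_eq_vec_def less_imp_le intro!: sum_nonneg)
  with 1 2 3 show ?thesis unfolding dual_feasible_def by blast
qed

lemma dual_optimal_imp_value:
  assumes x: "x \<in> poly_set A b" and dual: "dual_optimal A b w \<delta> a g c h x \<pi>1 \<pi>2 \<gamma> \<tau> l \<kappa>"
  shows "\<tau> = f x"
proof (rule antisym)
  show "\<tau> \<le> f x" using dual_attains_ftilde[OF x] dual unfolding dual_optimal_def by blast
  obtain y where y: "y \<in> region x" "ratio y = f x" using ftilde_maximum(1)[OF x] by blast
  have "a \<bullet> y + g \<le> \<tau> * (c \<bullet> y + h)"
    using dual_feasible_imp_numerator_le[of A b w \<delta> a g c h x \<pi>1 \<pi>2 \<gamma> \<tau> l \<kappa> y x] dual y(1)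
    by (simp add: dual_optimal_def region_def)
  then show "f x \<le> \<tau>" using y(2) region_denom_pos[OF y(1)] by (simp add: field_simps flip: y(2))
qed

text \<open>
The optimal dual has value \<open>f x\<close>, so its \<open>\<pi>1 - \<pi>2\<close> is an admissible rate \<open>p\<close>, and \<open>c \<bullet> z + h = 1 / \<theta>\<close> turns
the division by the denominator into the factor \<open>\<theta>\<close>. The frontier of the polytope joins the null set
because \<open>f\<close> is only controlled inside.
\<close>

lemma gradient_formula:
  obtains B where "B \<subseteq> poly_set A b" "B \<in> null_sets lebesgue"
    "\<And>x y \<theta> q \<pi>1 \<pi>2 \<gamma> \<tau> l \<kappa>. x \<in> poly_set A b - B \<Longrightarrow>
       primal_optimal A b w \<delta> a g c h x y \<theta> q \<Longrightarrow>
       dual_optimal A b w \<delta> a g c h x \<pi>1 \<pi>2 \<gamma> \<tau> l \<kappa> \<Longrightarrow>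
       x \<in> interior (poly_set A b) \<and> GDERIV f x :> \<theta> *\<^sub>R (\<pi>1 - \<pi>2)"
proof -
  obtain N where N: "negligible N"
    "\<And>x z p. x \<in> interior (poly_set A b) - N \<Longrightarrow> z \<in> optimal_set x \<Longrightarrow>
       (\<And>x' y. x' \<in> poly_set A b \<Longrightarrow> y \<in> region x' \<Longrightarrow>
          a \<bullet> y + g - f x * (c \<bullet> y + h) \<le> p \<bullet> (x' - x)) \<Longrightarrow>
       GDERIV f x :> p /\<^sub>R (c \<bullet> z + h)"
    using gradient_almost_everywhere by blast
  let ?B = "poly_set A b \<inter> (N \<union> frontier (poly_set A b))"
  show thesis
  proof (rule that[of ?B])
    show "?B \<subseteq> poly_set A b" by blast
    have "negligible ?B"
      by (rule negligible_subset[of "N \<union> frontier (poly_set A b)"])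
        (auto intro: N(1) negligible_convex_frontier convex_poly_set)
    then show "?B \<in> null_sets lebesgue" by (simp add: negligible_iff_null_sets)
    fix x y \<theta> q \<pi>1 \<pi>2 \<gamma> \<tau> l \<kappa>
    assume x: "x \<in> poly_set A b - ?B" and primal: "primal_optimal A b w \<delta> a g c h x y \<theta> q"
      and dual: "dual_optimal A b w \<delta> a g c h x \<pi>1 \<pi>2 \<gamma> \<tau> l \<kappa>"
    have xS: "x \<in> poly_set A b" and int: "x \<in> interior (poly_set A b) - N"
      using x closed_poly_set[of A b] by (auto simp: frontier_def)
    have "primal_feasible A b w \<delta> c h x y \<theta> q" using primal by (simp add: primal_optimal_def)
    note z = primal_feasible_imp_region[OF this]
    have "\<tau> = f x" using dual_optimal_imp_value[OF xS dual] .
    then have "dual_feasible A b w \<delta> a g c h x \<pi>1 \<pi>2 \<gamma> (f x) l \<kappa>"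
      using dual by (simp add: dual_optimal_def)
    then have "GDERIV f x :> (\<pi>1 - \<pi>2) /\<^sub>R (c \<bullet> (y /\<^sub>R \<theta>) + h)"
      by (intro N(2)[OF int primal_optimal_imp_optimal_set[OF xS primal]] dual_feasible_imp_numerator_le)
        (auto simp: region_def)
    then show "x \<in> interior (poly_set A b) \<and> GDERIV f x :> \<theta> *\<^sub>R (\<pi>1 - \<pi>2)"
      using int unfolding z(3) by simp
  qed
qed

end

theorem proposition8:
  fixes A :: "real^'n^'k" and b :: "real^'k"
    and a c :: "nat \<Rightarrow> real^'n" and g h :: "nat \<Rightarrow> real"
    and w :: "real^'n" and \<delta> :: real and m i :: nat
  assumes "compact (poly_set A b)"
    and "\<And>j x. j \<in> {1..m} \<Longrightarrow> x \<in> poly_set A b \<Longrightarrow> c j \<bullet> x + h j > 0"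
    and "\<And>j. w $ j > 0"
    and "\<delta> > 0"
    and "i \<in> {1..m}"
  shows "(\<forall>x\<in>poly_set A b. \<exists>y \<theta> q.
            primal_optimal A b w \<delta> (a i) (g i) (c i) (h i) x y \<theta> q \<and>
            ftilde A b w \<delta> (a i) (g i) (c i) (h i) x = a i \<bullet> y + g i * \<theta>) \<and>
         (\<exists>B. B \<subseteq> poly_set A b \<and> B \<in> null_sets lebesgue \<and>
           (\<forall>x \<in> poly_set A b - B. \<forall>y \<theta> q \<pi>1 \<pi>2 \<gamma> \<tau> l \<kappa>.
              primal_optimal A b w \<delta> (a i) (g i) (c i) (h i) x y \<theta> q \<longrightarrow>
              dual_optimal A b w \<delta> (a i) (g i) (c i) (h i) x \<pi>1 \<pi>2 \<gamma> \<tau> l \<kappa> \<longrightarrow>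
              x \<in> interior (poly_set A b) \<and>
              GDERIV (ftilde A b w \<delta> (a i) (g i) (c i) (h i)) x :> \<theta> *\<^sub>R (\<pi>1 - \<pi>2)))"
proof -
  interpret neighbourhood_fractional_maximum A b w \<delta> "a i" "c i" "g i" "h i"
    using assms by unfold_locales auto
  obtain B where "B \<subseteq> poly_set A b" "B \<in> null_sets lebesgue"
    "\<And>x y \<theta> q \<pi>1 \<pi>2 \<gamma> \<tau> l \<kappa>. x \<in> poly_set A b - B \<Longrightarrow>
       primal_optimal A b w \<delta> (a i) (g i) (c i) (h i) x y \<theta> q \<Longrightarrow>
       dual_optimal A b w \<delta> (a i) (g i) (c i) (h i) x \<pi>1 \<pi>2 \<gamma> \<tau> l \<kappa> \<Longrightarrow>
       x \<in> interior (poly_set A b) \<and> GDERIV f x :> \<theta> *\<^sub>R (\<pi>1 - \<pi>2)"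
    using gradient_formula by blast
  then show ?thesis
    using primal_attains_ftilde by (intro conjI ballI exI[of _ B]) auto
qed

end
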